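(* For $\gamma>0$ define $$g(\gamma)=\int_0^{+\infty}\gamma t\,\exp(-\gamma(1+t))\,I_0\!\left(2\gamma\sqrt t\right)\left(1-R^2\!\left(2\gamma\sqrt t\right)\right)\mathrm{d}t$$ and $$\hat g(\gamma)=\frac14\sqrt{\frac{\pi}{\gamma}}\,e^{-\gamma/2}\left(\left(1+\frac1\gamma\right)I_0(\gamma/2)+I_1(\gamma/2)\right).$$ Then the relative error of $1/\gamma-\hat g(\gamma)$ as an approximation of $1/\gamma-g(\gamma)$ satisfies $$r(\gamma)=\frac{|\hat g(\gamma)-g(\gamma)|}{1/\gamma-g(\gamma)}=\mathcal{O}\!\left(\frac1\gamma\right)\qquad\text{as }\gamma\to+\infty .$$
   Context: $I_\nu$ denotes the $\nu$-th order modified Bessel function of the first kind, and $R(z)=I_1(z)/I_0(z)$. *)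

theory Defs
  imports "HOL-Analysis.Analysis" "HOL-Library.Landau_Symbols"
begin

definition besselI :: "nat \<Rightarrow> real \<Rightarrow> real" where
  "besselI n z = (\<Sum>k. (z / 2) ^ (2 * k + n) / (fact k * fact (k + n)))"

definition besselR :: "real \<Rightarrow> real" where
  "besselR z = besselI 1 z / besselI 0 z"

definition g_fun :: "real \<Rightarrow> real" where
  "g_fun \<gamma> = integral {0..} (\<lambda>t. \<gamma> * t * exp (- \<gamma> * (1 + t)) * besselI 0 (2 * \<gamma> * sqrt t)
                   * (1 - (besselR (2 * \<gamma> * sqrt t))\<^sup>2))"

definition g_hat :: "real \<Rightarrow> real" where
  "g_hat \<gamma> = 1/4 * sqrt (pi / \<gamma>) * exp (- \<gamma> / 2) *
     ((1 + 1 / \<gamma>) * besselI 0 (\<gamma> / 2) + besselI 1 (\<gamma> / 2))"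

definition rel_err :: "real \<Rightarrow> real" where
  "rel_err \<gamma> = \<bar>g_hat \<gamma> - g_fun \<gamma>\<bar> / (1 / \<gamma> - g_fun \<gamma>)"

end

(* Let z = 2 * gamma * sqrt t. Replacing 1 - R(z)^2 by its leading term 1 / z in g gives exactly
   g_hat: integrate the power series of I_0 termwise and use Kummer's identity
   sum (1/2)_k x^k / (k!)^2 = exp (x / 2) * I_0 (x / 2).
   The pointwise error |1 / z - (1 - R(z)^2)| is at most 2 / z^2 for every z > 0; it comes from
   D = z (I_0^2 - I_1^2) - I_0^2, whose derivative is (I_0 - I_1)^2.  Since the measure
   exp (- gamma (1 + t)) I_0(z) dt on [0, oo) has mass 1 / gamma, |g_hat - g| <= 1 / (2 gamma^2).
   Finally sqrt t <= (1 + t) / 2 gives g_hat <= 1 / (2 gamma) + 1 / (4 gamma^2), so that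
   1 / gamma - g is at least 1 / (4 gamma) for gamma >= 3. *)

theory Submission
  imports Defs
begin

subsection \<open>The functions \<open>I\<^sub>0\<close> and \<open>I\<^sub>1\<close>\<close>

text \<open>Keeps the order in \<open>besselI 1\<close> from being rewritten to
  \<open>Suc 0\<close>, so that facts about order one still match.\<close>

declare One_nat_def [simp del]

section \<open>Power series of I_0 and I_1\<close>

lemma summable_bessel_series: "summable (\<lambda>k. x ^ k / (fact k * fact (k + n)) :: real)"
proof (rule summable_comparison_test[OF _ summable_exp[of "\<bar>x\<bar>"]], intro exI allI impI)
  fix k :: nat
  have "fact k * 1 \<le> (fact k * fact (k + n) :: real)"
    by (intro mult_left_mono) auto
  then have "\<bar>x\<bar> ^ k / (fact k * fact (k + n)) \<le> \<bar>x\<bar> ^ k / fact k"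
    by (intro divide_left_mono) auto
  then show "norm (x ^ k / (fact k * fact (k + n))) \<le> inverse (fact k) * \<bar>x\<bar> ^ k"
    by (simp add: power_abs abs_mult divide_inverse mult_ac)
qed

text \<open>Pulling out (z/2)^n leaves an entire power series in z^2/4, which can be differentiated
  termwise and then treated by the chain rule.\<close>

lemma besselI_sums:
  "(\<lambda>k. (z / 2) ^ n * ((z\<^sup>2 / 4) ^ k / (fact k * fact (k + n)))) sums besselI n z"
proof -
  have "(z / 2) ^ n * ((z\<^sup>2 / 4) ^ k / (fact k * fact (k + n)))
      = (z / 2) ^ (2 * k + n) / (fact k * fact (k + n))" for k
  proof -
    have "(z / 2) ^ (2 * k + n) = ((z / 2)\<^sup>2) ^ k * (z / 2) ^ n"
      by (simp only: power_add power_mult)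
    also have "(z / 2)\<^sup>2 = z\<^sup>2 / 4" by (simp add: power_divide)
    finally show ?thesis by simp
  qed
  note eq = this
  show ?thesis
    using summable_sums[OF summable_mult[OF summable_bessel_series, of "(z / 2) ^ n" "z\<^sup>2 / 4" n]]
    unfolding eq besselI_def .
qed

lemma besselI_eq: "besselI n z = (z / 2) ^ n * (\<Sum>k. (z\<^sup>2 / 4) ^ k / (fact k * fact (k + n)))"
  using sums_unique[OF besselI_sums] suminf_mult[OF summable_bessel_series] by metis

lemma besselI_nonneg: "0 \<le> z \<Longrightarrow> 0 \<le> besselI n z"
  unfolding besselI_eq by (intro mult_nonneg_nonneg suminf_nonneg summable_bessel_series) auto

lemma summable_besselI_0: "summable (\<lambda>k. x ^ k / (fact k)\<^sup>2 :: real)"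
  using summable_bessel_series[of x 0] by (simp add: power2_eq_square)

lemma besselI_0_sums: "(\<lambda>k. (z\<^sup>2 / 4) ^ k / (fact k)\<^sup>2) sums besselI 0 z"
  using besselI_sums[of z 0] by (simp add: power2_eq_square)

text \<open>These are the first two terms of a series with nonnegative terms.\<close>

lemma besselI_0_ge: "1 + z\<^sup>2 / 4 \<le> besselI 0 z"
  using sum_le_suminf[OF sums_summable[OF besselI_0_sums[of z]], of "{..<2}"] sums_unique[OF besselI_0_sums[of z]]
  by (simp add: numeral_2_eq_2)

lemma besselI_0_pos: "0 < besselI 0 z"
  using besselI_0_ge[of z] zero_le_power2[of z] by linarith

lemma besselI_0_0 [simp]: "besselI 0 0 = 1"
proof -
  have "(\<lambda>k. (0::real) ^ k / (fact k)\<^sup>2) sums 1"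
    using powser_sums_zero[of "\<lambda>k. 1 / (fact k)\<^sup>2 :: real"] by simp
  then show ?thesis using sums_unique2 besselI_0_sums[of 0] by simp
qed

lemma summable_besselI_1: "summable (\<lambda>k. x ^ k / (fact k * fact (Suc k)) :: real)"
  using summable_bessel_series[of x 1] by (simp add: One_nat_def del: fact_Suc)

lemma besselI_1_eq: "besselI 1 z = z / 2 * (\<Sum>k. (z\<^sup>2 / 4) ^ k / (fact k * fact (Suc k)))"
  using besselI_eq[of 1 z] by (simp add: One_nat_def del: fact_Suc)

lemma besselI_1_0 [simp]: "besselI 1 0 = 0"
  by (simp add: besselI_1_eq)

section \<open>Derivatives of I_0 and I_1\<close>

lemma DERIV_quarter_square: "((\<lambda>z. z\<^sup>2 / 4) has_real_derivative z / 2) (at z)" for z :: real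
  by (auto intro!: derivative_eq_intros)

lemma DERIV_besselI_0: "(besselI 0 has_real_derivative besselI 1 z) (at z)"
proof -
  let ?c = "\<lambda>k. 1 / (fact k)\<^sup>2 :: real"
  have d: "diffs ?c = (\<lambda>k. 1 / (fact k * fact (Suc k)))"
    by (auto simp: diffs_def fun_eq_iff power2_eq_square divide_simps) 
  have "((\<lambda>x. \<Sum>k. ?c k * x ^ k) has_real_derivative (\<Sum>k. diffs ?c k * (z\<^sup>2/4) ^ k)) (at (z\<^sup>2 / 4))"
    using summable_besselI_0 by (intro termdiffs_strong_converges_everywhere) simp
  from DERIV_chain2[where g = "\<lambda>z. z\<^sup>2 / 4" and x = z, OF this DERIV_quarter_square]
  have "((\<lambda>z. \<Sum>k. ?c k * (z\<^sup>2/4) ^ k) has_real_derivative (\<Sum>k. diffs ?c k * (z\<^sup>2/4) ^ k) * (z / 2)) (at z)"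
    .
  moreover have "(\<lambda>z. \<Sum>k. ?c k * (z\<^sup>2/4) ^ k) = besselI 0"
    using sums_unique[OF besselI_0_sums] by (simp add: fun_eq_iff)
  ultimately show ?thesis
    unfolding d besselI_1_eq by (simp add: mult.commute)
qed

text \<open>Stated without division, so that it also covers the removable singularity at \<open>z = 0\<close>.\<close>

lemma DERIV_besselI_1:
  obtains d where "(besselI 1 has_real_derivative d) (at z)" "z * d = z * besselI 0 z - besselI 1 z"
proof -
  let ?c = "\<lambda>k. 1 / (fact k * fact (Suc k)) :: real"
  \<comment> \<open>Coefficients, in x = z^2/4, of z/2 * I_1(z). One formal differentiation turns
    them into 1/(k!)^2, the coefficients of I_0.\<close>
  let ?e = "\<lambda>k. real k / (fact k)\<^sup>2"
  have "((\<lambda>x. \<Sum>k. ?c k * x ^ k) has_real_derivative (\<Sum>k. diffs ?c k * (z\<^sup>2/4) ^ k)) (at (z\<^sup>2 / 4))"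
    using summable_besselI_1 by (intro termdiffs_strong_converges_everywhere) (simp del: fact_Suc)
  from DERIV_chain2[where g = "\<lambda>z. z\<^sup>2 / 4" and x = z, OF this DERIV_quarter_square]
  have 1: "((\<lambda>z. \<Sum>k. ?c k * (z\<^sup>2/4) ^ k) has_real_derivative (\<Sum>k. diffs ?c k * (z\<^sup>2/4) ^ k) * (z / 2)) (at z)"
    .
  have eq: "besselI 1 = (\<lambda>z. z / 2 * (\<Sum>k. ?c k * (z\<^sup>2/4) ^ k))"
    by (simp add: fun_eq_iff besselI_1_eq del: fact_Suc)
  obtain d where d: "(besselI 1 has_real_derivative d) (at z)"
    unfolding eq using DERIV_mult[OF DERIV_cdivide[OF DERIV_ident] 1] by blast
  have e: "?e (Suc k) = ?c k" for k
    by (simp add: power2_eq_square field_simps del: of_nat_Suc) 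
  have sums: "(\<lambda>k. ?e k * x ^ k) sums (x * (\<Sum>k. ?c k * x ^ k))" for x :: real
  proof -
    have "(\<lambda>k. ?e (Suc k) * x ^ Suc k) sums (x * (\<Sum>k. ?c k * x ^ k))"
      unfolding e using sums_mult[OF summable_sums[OF summable_besselI_1[of x]], of x]
      by (simp add: mult_ac del: fact_Suc)
    from sums_Suc_imp[OF _ this] show ?thesis by simp
  qed
  have de: "diffs ?e = (\<lambda>k. 1 / (fact k)\<^sup>2)"
    by (auto simp: diffs_def fun_eq_iff power2_eq_square divide_simps simp del: of_nat_Suc)
  have "((\<lambda>x. \<Sum>k. ?e k * x ^ k) has_real_derivative (\<Sum>k. diffs ?e k * (z\<^sup>2/4) ^ k)) (at (z\<^sup>2 / 4))"
    using sums_summable[OF sums] by (intro termdiffs_strong_converges_everywhere)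
  from DERIV_chain2[where g = "\<lambda>z. z\<^sup>2 / 4" and x = z, OF this DERIV_quarter_square]
  have "((\<lambda>z. \<Sum>k. ?e k * (z\<^sup>2/4) ^ k) has_real_derivative (\<Sum>k. diffs ?e k * (z\<^sup>2/4) ^ k) * (z / 2)) (at z)"
    .
  moreover have "(\<lambda>z. \<Sum>k. ?e k * (z\<^sup>2/4) ^ k) = (\<lambda>z. z / 2 * besselI 1 z)"
    unfolding besselI_1_eq sums_unique[OF sums, symmetric]
    by (simp add: fun_eq_iff power2_eq_square del: fact_Suc)
  moreover have "(\<Sum>k. diffs ?e k * (z\<^sup>2/4) ^ k) = besselI 0 z"
    unfolding de using sums_unique[OF besselI_0_sums[of z]] by simp
  ultimately have "((\<lambda>z. z / 2 * besselI 1 z) has_real_derivative besselI 0 z * (z / 2)) (at z)"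
    by simp
  \<comment> \<open>The product rule differentiates the same function through \<open>d\<close>;
    comparing the two derivatives gives the identity, also at z = 0.\<close>
  moreover have "((\<lambda>z. z / 2 * besselI 1 z) has_real_derivative besselI 1 z / 2 + z / 2 * d) (at z)"
    by (rule derivative_eq_intros d refl | simp)+
  ultimately have "besselI 0 z * (z / 2) = besselI 1 z / 2 + z / 2 * d"
    by (rule DERIV_unique)
  then have "z * d = z * besselI 0 z - besselI 1 z" by (simp add: algebra_simps)
  with d show ?thesis by (rule that)
qed

section \<open>Inequalities for I_0 and I_1 by monotonicity\<close>

lemma exp_DERIV_nonneg:
  fixes f f' :: "real \<Rightarrow> real"
  assumes "0 \<le> f 0" "0 \<le> z"
    and "\<And>x. 0 \<le> x \<Longrightarrow> (f has_real_derivative f' x) (at x)"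
    and "\<And>x. 0 \<le> x \<Longrightarrow> 0 \<le> f x + f' x"
  shows "0 \<le> f z"
proof -
  \<comment> \<open>Integrating factor: the derivative of exp x * f x is exp x * (f x + f' x), which
    is nonnegative.\<close>
  have "exp 0 * f 0 \<le> exp z * f z"
  proof (rule DERIV_nonneg_imp_nondecreasing[OF \<open>0 \<le> z\<close>])
    fix x :: real assume x: "0 \<le> x"
    have "((\<lambda>x. exp x * f x) has_real_derivative exp x * (f x + f' x)) (at x)"
      by (auto intro!: derivative_eq_intros assms(3)[OF x] simp: algebra_simps)
    then show "\<exists>y. ((\<lambda>x. exp x * f x) has_real_derivative y) (at x) \<and> 0 \<le> y"
      using assms(4)[OF x] by auto
  qed
  with assms(1) have "0 \<le> exp z * f z" by simp
  then show ?thesis by (simp add: zero_le_mult_iff)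
qed

text \<open>Since z I_1' = z I_0 - I_1, the function f = z (I_0 - I_1) satisfies f + f' = I_0, the
  form that \<open>exp_DERIV_nonneg\<close> exploits.\<close>

lemma DERIV_mult_besselI_diff:
  "((\<lambda>z. z * (besselI 0 z - besselI 1 z)) has_real_derivative
     besselI 0 z - z * (besselI 0 z - besselI 1 z)) (at z)"
proof -
  obtain d where d: "(besselI 1 has_real_derivative d) (at z)" "z * d = z * besselI 0 z - besselI 1 z"
    by (rule DERIV_besselI_1)
  show ?thesis
    by (rule derivative_eq_intros DERIV_besselI_0 d(1) refl)+ (use d(2) in \<open>simp add: algebra_simps\<close>)
qed

text \<open>For f = z (I_0 - I_1), f(0) = 0 and f + f' = I_0 > 0 give f \<ge> 0; cancelling the
  factor z requires z > 0.\<close>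

lemma besselI_1_le_0:
  assumes "0 \<le> z"
  shows "besselI 1 z \<le> besselI 0 z"
proof (cases "z = 0")
  case False
  have "0 \<le> z * (besselI 0 z - besselI 1 z)"
    by (rule exp_DERIV_nonneg[OF _ assms DERIV_mult_besselI_diff])
      (use besselI_0_pos in \<open>simp_all add: less_imp_le\<close>)
  with False assms show ?thesis by (simp add: zero_le_mult_iff)
qed simp

text \<open>The difference h = I_0 - z (I_0 - I_1) has h(0) = 1 and h + h' = I_1 \<ge> 0.\<close>

lemma mult_besselI_diff_le:
  assumes "0 \<le> z"
  shows "z * (besselI 0 z - besselI 1 z) \<le> besselI 0 z"
proof -
  have "0 \<le> besselI 0 z - z * (besselI 0 z - besselI 1 z)"
  proof (rule exp_DERIV_nonneg[OF _ assms])
    fix x :: real assume "0 \<le> x"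
    show "((\<lambda>z. besselI 0 z - z * (besselI 0 z - besselI 1 z)) has_real_derivative
        besselI 1 x - (besselI 0 x - x * (besselI 0 x - besselI 1 x))) (at x)"
      by (intro DERIV_diff DERIV_besselI_0 DERIV_mult_besselI_diff)
    show "0 \<le> besselI 0 x - x * (besselI 0 x - besselI 1 x) +
        (besselI 1 x - (besselI 0 x - x * (besselI 0 x - besselI 1 x)))"
      using besselI_nonneg[OF \<open>0 \<le> x\<close>, of 1] by simp
  qed simp
  then show ?thesis by simp
qed

text \<open>\<open>besselD z / (z (besselI 0 z)\<^sup>2)\<close> is the error \<open>(1 - R\<^sup>2) - 1 / z\<close> made by
  the leading term of the large-\<open>z\<close> expansion of \<open>1 - R\<^sup>2\<close>.\<close>

definition besselD :: "real \<Rightarrow> real" where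
  "besselD z = z * ((besselI 0 z)\<^sup>2 - (besselI 1 z)\<^sup>2) - (besselI 0 z)\<^sup>2"

text \<open>Substituting z I_1' = z I_0 - I_1 cancels every term with a factor z; a perfect square
  remains.\<close>

lemma DERIV_besselD: "(besselD has_real_derivative (besselI 0 z - besselI 1 z)\<^sup>2) (at z)"
proof -
  obtain d where d: "(besselI 1 has_real_derivative d) (at z)" "z * d = z * besselI 0 z - besselI 1 z"
    by (rule DERIV_besselI_1)
  show ?thesis
    unfolding besselD_def[abs_def] power2_eq_square
    by (rule derivative_eq_intros DERIV_besselI_0 d(1) refl)+ (use d(2) in algebra)
qed

text \<open>\<open>besselD\<close> is nondecreasing, its derivative being a square, and starts at
  -1.\<close>

lemma besselD_ge:
  assumes "0 \<le> z"
  shows "- 1 \<le> besselD z"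
proof -
  have "besselD 0 \<le> besselD z"
    by (rule DERIV_nonneg_imp_nondecreasing[OF assms]) (use DERIV_besselD zero_le_power2 in blast)
  then show ?thesis by (simp add: besselD_def)
qed

text \<open>Factor I_0^2 - I_1^2 and apply z (I_0 - I_1) \<le> I_0 to the first factor.\<close>

lemma besselD_le:
  assumes "0 \<le> z"
  shows "besselD z \<le> besselI 0 z * besselI 1 z"
proof -
  have "z * (besselI 0 z - besselI 1 z) * (besselI 0 z + besselI 1 z)
      \<le> besselI 0 z * (besselI 0 z + besselI 1 z)"
    using mult_besselI_diff_le[OF assms] besselI_nonneg[OF assms]
    by (intro mult_right_mono) auto
  then show ?thesis by (simp add: besselD_def algebra_simps power2_eq_square)
qed

text \<open>On [0, 2] the crude bound D \<le> I_0^2 suffices; beyond 2 the difference of the two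
  sides is nondecreasing.\<close>

lemma mult_besselD_le:
  assumes "0 \<le> z"
  shows "z * besselD z \<le> 2 * (besselI 0 z)\<^sup>2"
proof -
  have small: "x * besselD x \<le> 2 * (besselI 0 x)\<^sup>2" if x: "0 \<le> x" "x \<le> 2" for x
  proof -
    have "besselD x \<le> (besselI 0 x)\<^sup>2"
      using besselD_le[OF x(1)] mult_left_mono[OF besselI_1_le_0[OF x(1)] besselI_nonneg[OF x(1), of 0]]
      by (simp add: power2_eq_square)
    then have "x * besselD x \<le> x * (besselI 0 x)\<^sup>2" using x(1) by (rule mult_left_mono)
    also have "\<dots> \<le> 2 * (besselI 0 x)\<^sup>2" using x(2) by (intro mult_right_mono) auto
    finally show ?thesis .
  qed
  show ?thesis
  proof (cases "z \<le> 2")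
    case False
    let ?q = "\<lambda>z. 2 * (besselI 0 z)\<^sup>2 - z * besselD z"
    have "?q 2 \<le> ?q z"
    proof (rule DERIV_nonneg_imp_nondecreasing[where f = ?q])
      show "2 \<le> z" using False by simp
      fix x :: real assume x: "2 \<le> x"
      let ?u = "besselI 0 x - besselI 1 x"
      have n: "0 \<le> besselI 0 x" "0 \<le> besselI 1 x" "0 \<le> ?u"
        using x besselI_nonneg besselI_1_le_0 by auto
      have xu: "x * ?u \<le> besselI 0 x" using x mult_besselI_diff_le by simp
      \<comment> \<open>This is where x \<ge> 2 enters: 2 (I_0 - I_1) \<le> I_0 means I_0 \<le> 2
        I_1.\<close>
      have "2 * ?u \<le> x * ?u" using x n by (intro mult_right_mono) auto
      with xu have "besselI 0 x \<le> 2 * besselI 1 x" by simp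
      from mult_left_mono[OF this n(1)]
      have 1: "(besselI 0 x)\<^sup>2 \<le> 2 * (besselI 0 x * besselI 1 x)"
        by (simp add: power2_eq_square)
      from mult_right_mono[OF xu n(3)]
      have 2: "x * ?u\<^sup>2 \<le> (besselI 0 x)\<^sup>2 - besselI 0 x * besselI 1 x"
        by (simp add: power2_eq_square algebra_simps)
      have 3: "0 \<le> besselI 0 x * besselI 1 x" using n by simp
      have "(?q has_real_derivative 4 * (besselI 0 x * besselI 1 x) - (besselD x + x * ?u\<^sup>2)) (at x)"
        by (rule derivative_eq_intros DERIV_besselI_0 DERIV_besselD refl | simp)+
      \<comment> \<open>Both D and x u^2 are at most I_0 I_1, so the derivative is at least 2 I_0
        I_1.\<close>
      moreover have "0 \<le> 4 * (besselI 0 x * besselI 1 x) - (besselD x + x * ?u\<^sup>2)"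
        using 1 2 3 besselD_le[of x] x by simp
      ultimately show "\<exists>y. (?q has_real_derivative y) (at x) \<and> 0 \<le> y" by blast
    qed
    with small[of 2] show ?thesis by simp
  qed (use small assms in blast)
qed

text \<open>For the lower side, D \<ge> -1 gives z D \<ge> -z, and z \<le> I_0 \<le> I_0^2.\<close>

lemma abs_mult_besselD_le:
  assumes "0 \<le> z"
  shows "\<bar>z * besselD z\<bar> \<le> 2 * (besselI 0 z)\<^sup>2"
proof -
  have "z \<le> 1 + z\<^sup>2 / 4" using zero_le_power2[of "z / 2 - 1"] by (simp add: power2_eq_square algebra_simps)
  with besselI_0_ge[of z] have "z \<le> besselI 0 z" by simp
  moreover have "1 \<le> besselI 0 z" using besselI_0_ge[of z] zero_le_power2[of z] by linarith
  ultimately have "z * 1 \<le> besselI 0 z * besselI 0 z" using assms by (intro mult_mono) auto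
  moreover have "z * - 1 \<le> z * besselD z" using besselD_ge[OF assms] assms by (rule mult_left_mono)
  moreover have "0 \<le> (besselI 0 z)\<^sup>2" by simp
  ultimately have "- (2 * (besselI 0 z)\<^sup>2) \<le> z * besselD z" unfolding power2_eq_square by linarith
  with mult_besselD_le[OF assms] show ?thesis by linarith
qed

text \<open>The error equals -D / (z I_0^2). Expanding the fraction by z brings in z D, which is at
  most 2 I_0^2 in absolute value.\<close>

lemma besselR_asymptotic:
  assumes "0 < z"
  shows "\<bar>1 / z - (1 - (besselR z)\<^sup>2)\<bar> \<le> 2 / z\<^sup>2"
proof -
  have "1 / z - (1 - (besselR z)\<^sup>2) = - (z * besselD z / ((besselI 0 z)\<^sup>2 * z\<^sup>2))"
    using assms besselI_0_pos[of z]
    by (simp add: besselR_def besselD_def field_simps power2_eq_square)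
  also have "\<bar>\<dots>\<bar> = \<bar>z * besselD z\<bar> / ((besselI 0 z)\<^sup>2 * z\<^sup>2)"
    by (simp add: abs_mult)
  also have "\<dots> \<le> 2 * (besselI 0 z)\<^sup>2 / ((besselI 0 z)\<^sup>2 * z\<^sup>2)"
    using assms by (intro divide_right_mono abs_mult_besselD_le) auto
  also have "\<dots> = 2 / z\<^sup>2" using besselI_0_pos[of z] by simp
  finally show ?thesis .
qed

subsection \<open>Kummer's identity\<close>

text \<open>The Taylor series of I_0(x/2): with z = x/2, z^2/4 = x^2/16.\<close>

definition bessel_fps :: "real fps" where
  "bessel_fps = Abs_fps (\<lambda>n. if even n then 1 / (16 ^ (n div 2) * (fact (n div 2))\<^sup>2) else 0)"

lemma bessel_fps_sums: "(\<lambda>n. fps_nth bessel_fps n * x ^ n) sums besselI 0 (x / 2)"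
proof -
  have "(\<lambda>n. if even n then (((x/2)\<^sup>2 / 4) ^ (n div 2) / (fact (n div 2))\<^sup>2) else 0) sums (0 + besselI 0 (x/2))"
    using sums_if[OF sums_zero besselI_0_sums[of "x / 2"]] .
  moreover have "(if even n then (((x/2)\<^sup>2 / 4) ^ (n div 2) / (fact (n div 2))\<^sup>2) else 0)
      = fps_nth bessel_fps n * x ^ n" for n
    by (auto simp: bessel_fps_def power_divide elim!: evenE simp flip: power_mult)
  ultimately show ?thesis by simp
qed

lemma fps_conv_radius_bessel: "fps_conv_radius bessel_fps = \<infinity>"
  unfolding fps_conv_radius_def
  by (rule conv_radius_inftyI'') (rule sums_summable[OF bessel_fps_sums])

lemma eval_bessel_fps: "eval_fps bessel_fps x = besselI 0 (x / 2)"
  unfolding eval_fps_def by (rule sums_unique[OF bessel_fps_sums, symmetric])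

text \<open>The modified Bessel equation of order 0, rescaled to x/2. On coefficients it says 16
  (k+1)^2 c_(k+1) = c_k.\<close>

lemma bessel_fps_ode:
  "fps_X * fps_deriv (fps_deriv bessel_fps) + fps_deriv bessel_fps = fps_const (1/4) * (fps_X * bessel_fps)"
proof (rule fps_ext)
  fix n
  define c :: "nat \<Rightarrow> real" where "c k = 1 / (16 ^ k * (fact k)\<^sup>2)" for k
  have nth: "fps_nth bessel_fps n = (if even n then c (n div 2) else 0)" for n
    by (simp add: bessel_fps_def c_def)
  have c_Suc: "(real k + 1)\<^sup>2 * (16 * c (Suc k)) = c k" for k
    by (simp add: c_def power_mult_distrib field_simps del: of_nat_Suc)
  show "fps_nth (fps_X * fps_deriv (fps_deriv bessel_fps) + fps_deriv bessel_fps) n =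
    fps_nth (fps_const (1/4) * (fps_X * bessel_fps)) n"
  proof (cases n)
    case (Suc m)
    show ?thesis
    proof (cases "even m")
      case True
      then obtain k where "m = 2 * k" by blast
      with Suc show ?thesis
        by (simp add: nth) (use c_Suc[of k] in \<open>simp add: power2_eq_square algebra_simps\<close>)
    next
      case False
      with Suc show ?thesis by (simp add: nth)
    qed
  qed (simp add: nth)
qed

text \<open>The series of exp(x/2) I_0(x/2), which turns out to be the confluent hypergeometric
  series 1F1(1/2; 1; x).\<close>

definition kummer_fps :: "real fps" where
  "kummer_fps = fps_exp (1/2) * bessel_fps"

text \<open>Kummer's equation x y'' + (b - x) y' = a y with a = 1/2 and b = 1, obtained by
  substituting y = exp(x/2) w into the equation for w = I_0(x/2).\<close>

lemma kummer_fps_ode: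
  "fps_X * fps_deriv (fps_deriv kummer_fps) + (1 - fps_X) * fps_deriv kummer_fps
     = fps_const (1/2) * kummer_fps"
proof -
  \<comment> \<open>The constant 1/2 becomes an opaque ring element with h + h = 1, so that
    \<open>algebra\<close> needs no division.\<close>
  define h :: "real fps" where "h = fps_const (1/2)"
  have h: "fps_const (1/4) = h * h" "h + h = 1" "fps_deriv h = 0"
    by (simp_all add: h_def fps_const_add flip: fps_const_1_eq_1)
  define E :: "real fps" where "E = fps_exp (1/2)"
  have dE: "fps_deriv E = h * E" by (simp add: E_def h_def)
  have d: "fps_deriv kummer_fps = E * (h * bessel_fps + fps_deriv bessel_fps)"
    unfolding kummer_fps_def E_def[symmetric] fps_deriv_mult dE by algebra
  have dd: "fps_deriv (fps_deriv kummer_fps) = E *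
      (h * h * bessel_fps + (h + h) * fps_deriv bessel_fps + fps_deriv (fps_deriv bessel_fps))"
    unfolding d fps_deriv_mult fps_deriv_add dE h(3) by algebra
  have "fps_X * fps_deriv (fps_deriv kummer_fps) + (1 - fps_X) * fps_deriv kummer_fps =
      fps_X * (E * (h * h * bessel_fps + (h + h) * fps_deriv bessel_fps + fps_deriv (fps_deriv bessel_fps)))
      + (1 - fps_X) * (E * (h * bessel_fps + fps_deriv bessel_fps))"
    by (subst dd, subst d) (rule refl)
  also have "\<dots> = h * (E * bessel_fps)"
    using bessel_fps_ode[unfolded h(1)] h(2) by algebra
  finally show ?thesis
    by (simp only: kummer_fps_def E_def h_def)
qed

text \<open>Comparing coefficients in Kummer's equation gives (n+1)^2 a_(n+1) = (n + 1/2) a_n, with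
  a_0 = 1.\<close>

lemma kummer_fps_nth: "fps_nth kummer_fps n = pochhammer (1/2) n / (fact n)\<^sup>2"
proof (induction n)
  case 0
  then show ?case by (simp add: kummer_fps_def bessel_fps_def)
next
  case (Suc n)
  have "fps_nth (fps_X * fps_deriv (fps_deriv kummer_fps) + (1 - fps_X) * fps_deriv kummer_fps) n
     = fps_nth (fps_const (1/2) * kummer_fps) n"
    by (simp only: kummer_fps_ode)
  then have "(real n + 1)\<^sup>2 * fps_nth kummer_fps (Suc n) = (1/2 + real n) * fps_nth kummer_fps n"
    by (cases n) (simp_all add: One_nat_def algebra_simps power2_eq_square)
  then have "fps_nth kummer_fps (Suc n) = (1/2 + real n) * fps_nth kummer_fps n / (real n + 1)\<^sup>2"
    by (simp add: field_simps)
  then show ?case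
    by (simp add: Suc.IH pochhammer_Suc power_mult_distrib add_ac mult_ac)
qed

lemma fps_conv_radius_kummer: "fps_conv_radius kummer_fps = \<infinity>"
  using fps_conv_radius_mult[of "fps_exp (1/2)" bessel_fps]
  by (simp add: kummer_fps_def fps_conv_radius_bessel)

lemma eval_kummer_fps: "eval_fps kummer_fps x = exp (x / 2) * besselI 0 (x / 2)"
  unfolding kummer_fps_def by (simp add: eval_fps_mult fps_conv_radius_bessel eval_bessel_fps)

lemma eval_kummer_fps_deriv:
  "eval_fps (fps_deriv kummer_fps) x = exp (x / 2) * (besselI 0 (x / 2) + besselI 1 (x / 2)) / 2"
proof -
  have "(eval_fps kummer_fps has_real_derivative eval_fps (fps_deriv kummer_fps) x) (at x)"
    by (rule has_field_derivative_eval_fps) (simp add: fps_conv_radius_kummer)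
  moreover have "(eval_fps kummer_fps has_real_derivative
      exp (x / 2) * (besselI 0 (x / 2) + besselI 1 (x / 2)) / 2) (at x)"
    unfolding eval_kummer_fps[abs_def]
    by (rule derivative_eq_intros DERIV_chain2[OF DERIV_besselI_0] refl | simp add: algebra_simps)+
  ultimately show ?thesis by (rule DERIV_unique)
qed

text \<open>Since (3/2)_n = (2n+1) (1/2)_n, this series arises from the Kummer series by the
  operator 1 + 2x d/dx.\<close>

lemma kummer_three_halves_sums:
  "(\<lambda>n. pochhammer (3/2) n * x ^ n / (fact n)\<^sup>2) sums
     (exp (x / 2) * ((1 + x) * besselI 0 (x / 2) + x * besselI 1 (x / 2)))"
proof -
  let ?K = "kummer_fps + fps_const 2 * (fps_X * fps_deriv kummer_fps)"
  have "pochhammer (3/2 :: real) n = (2 * real n + 1) * pochhammer (1/2) n" for n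
    by (induction n) (simp_all add: pochhammer_Suc algebra_simps)
  then have nth: "fps_nth ?K n = pochhammer (3/2) n / (fact n)\<^sup>2" for n
    by (cases n) (simp_all add: One_nat_def kummer_fps_nth algebra_simps add_divide_distrib)
  have r: "fps_conv_radius (fps_deriv kummer_fps) = \<infinity>"
    using fps_conv_radius_deriv[of kummer_fps] by (simp add: fps_conv_radius_kummer)
  have "(\<lambda>n. fps_nth kummer_fps n * x ^ n) sums eval_fps kummer_fps x"
    by (rule sums_eval_fps) (simp add: fps_conv_radius_kummer)
  moreover have "(\<lambda>n. fps_nth (fps_X * fps_deriv kummer_fps) n * x ^ n) sums eval_fps (fps_X * fps_deriv kummer_fps) x"
  proof (rule sums_eval_fps)
    show "ereal (norm x) < fps_conv_radius (fps_X * fps_deriv kummer_fps)"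
      using fps_conv_radius_mult[of fps_X "fps_deriv kummer_fps"] by (simp add: r)
  qed
  ultimately have "(\<lambda>n. fps_nth kummer_fps n * x ^ n + 2 * (fps_nth (fps_X * fps_deriv kummer_fps) n * x ^ n)) sums
    (eval_fps kummer_fps x + 2 * eval_fps (fps_X * fps_deriv kummer_fps) x)"
    by (intro sums_add sums_mult)
  also have "eval_fps (fps_X * fps_deriv kummer_fps) x = x * eval_fps (fps_deriv kummer_fps) x"
    by (simp add: eval_fps_mult r)
  also have "(\<lambda>n. fps_nth kummer_fps n * x ^ n + 2 * (fps_nth (fps_X * fps_deriv kummer_fps) n * x ^ n))
     = (\<lambda>n. fps_nth ?K n * x ^ n)"
    by (simp add: fun_eq_iff distrib_right mult.assoc)
  finally show ?thesis
    unfolding nth eval_kummer_fps eval_kummer_fps_deriv by (simp add: algebra_simps add_divide_distrib)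
qed

subsection \<open>Moments\<close>

text \<open>Euler's integral after the substitution t -> a t. The integrand is nonnegative, so the
  substitution can be made in the Lebesgue integral of its extension by zero.\<close>

lemma Gamma_integral_scaled:
  fixes s a :: real
  assumes "0 < s" "0 < a"
  shows "((\<lambda>t. t powr (s - 1) * exp (- a * t)) has_integral Gamma s / a powr s) {0..}"
proof -
  let ?f = "\<lambda>t. if t \<in> {0..} then t powr (s - 1) / exp t else 0 :: real"
  let ?g = "\<lambda>t. if t \<in> {0..} then t powr (s - 1) * exp (- a * t) else 0 :: real"
  have f: "(?f has_integral Gamma s) UNIV"
    using Gamma_integral_real[OF assms(1)] by (subst has_integral_restrict_UNIV)
  have "has_bochner_integral lborel ?f (Gamma s)"
  proof (rule has_bochner_integral_nn_integral)
    show "?f \<in> borel_measurable lborel" by measurable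
    show "AE x in lborel. 0 \<le> ?f x" by simp
    show "0 \<le> Gamma s" using Gamma_real_nonneg assms by simp
    show "(\<integral>\<^sup>+ x. ennreal (?f x) \<partial>lborel) = ennreal (Gamma s)"
      by (rule nn_integral_has_integral_lborel[OF _ _ f]) (simp_all, measurable)
  qed
  then have "has_bochner_integral lborel (\<lambda>t. ?f (0 + a * t)) (Gamma s /\<^sub>R \<bar>a\<bar>)"
    using lborel_has_bochner_integral_real_affine_iff[of a ?f "Gamma s" 0] assms by simp
  moreover have "?f (0 + a * t) = a powr (s - 1) * ?g t" for t
    using assms by (auto simp: powr_mult zero_le_mult_iff exp_minus field_simps)
  ultimately have "has_bochner_integral lborel (\<lambda>t. a powr (s - 1) * ?g t) (Gamma s /\<^sub>R \<bar>a\<bar>)"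
    by simp
  then have "((\<lambda>t. a powr (s - 1) * ?g t) has_integral (Gamma s /\<^sub>R \<bar>a\<bar>)) UNIV"
    using has_integral_integral_lborel by (metis (lifting) has_bochner_integral_iff)
  from has_integral_mult_right[OF this, of "1 / a powr (s - 1)"]
  have "(?g has_integral (1 / a powr (s - 1) * (Gamma s /\<^sub>R \<bar>a\<bar>))) UNIV"
    using assms by simp
  moreover have "1 / a powr (s - 1) * (Gamma s /\<^sub>R \<bar>a\<bar>) = Gamma s / a powr s"
    using assms by (simp add: powr_diff field_simps)
  ultimately show ?thesis by (subst (asm) has_integral_restrict_UNIV) simp
qed

text \<open>The argument of I_0 is chosen so that z^2/4 = \<gamma>^2 t; each term of the series is
  then a Gamma integral. The terms are nonnegative, so monotone convergence permits termwise
  integration.\<close>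

lemma besselI_0_moment:
  fixes s \<gamma> :: real
  assumes "0 < s" "0 < \<gamma>" and sums: "(\<lambda>k. \<gamma> ^ k * Gamma (s + real k) / (fact k)\<^sup>2) sums S"
  shows "((\<lambda>t. t powr (s - 1) * (exp (- \<gamma> * (1 + t)) * besselI 0 (2 * \<gamma> * sqrt t)))
    has_integral exp (- \<gamma>) * (S / \<gamma> powr s)) {0..}"
proof -
  let ?a = "\<lambda>k. (\<gamma>\<^sup>2) ^ k / (fact k)\<^sup>2"
  let ?h = "\<lambda>t. t powr (s - 1) * exp (- \<gamma> * t)"
  have "((\<lambda>t. ?h t * besselI 0 (2 * \<gamma> * sqrt t)) has_integral S / \<gamma> powr s) {0..}"
  proof (rule has_integral_monotone_convergence_increasing)
    show "((\<lambda>t. \<Sum>k<n. ?a k * (t powr (s + real k - 1) * exp (- \<gamma> * t))) has_integral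
        (\<Sum>k<n. ?a k * (Gamma (s + real k) / \<gamma> powr (s + real k)))) {0..}" for n
      using assms by (intro has_integral_sum has_integral_mult_right Gamma_integral_scaled) auto
    show "(\<Sum>k<n. ?a k * (t powr (s + real k - 1) * exp (- \<gamma> * t)))
        \<le> (\<Sum>k<Suc n. ?a k * (t powr (s + real k - 1) * exp (- \<gamma> * t)))" for n t
      by simp
    show "(\<lambda>n. \<Sum>k<n. ?a k * (t powr (s + real k - 1) * exp (- \<gamma> * t)))
        \<longlonglongrightarrow> ?h t * besselI 0 (2 * \<gamma> * sqrt t)" if t: "t \<in> {0..}" for t
    proof -
      have "?h t * (((2 * \<gamma> * sqrt t)\<^sup>2 / 4) ^ k / (fact k)\<^sup>2)
          = ?a k * (t powr (s + real k - 1) * exp (- \<gamma> * t))" for k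
      \<comment> \<open>At t = 0 both sides vanish, because \<open>0 powr x = 0\<close> for every
        exponent, including 0.\<close>
      proof (cases "t = 0")
        case False
        with t have "t powr (s + real k - 1) = t powr (s - 1) * t ^ k"
          using powr_add[of t "s - 1" "real k"] by (simp add: powr_realpow algebra_simps)
        with t show ?thesis by (simp add: power_mult_distrib)
      qed simp
      note eq = this
      show ?thesis
        using sums_mult[OF besselI_0_sums[of "2 * \<gamma> * sqrt t"], of "?h t"]
        unfolding eq sums_def .
    qed
    have "?a k * (Gamma (s + real k) / \<gamma> powr (s + real k))
        = \<gamma> ^ k * Gamma (s + real k) / (fact k)\<^sup>2 / \<gamma> powr s" for k
      using \<open>0 < \<gamma>\<close>
      by (simp add: powr_add powr_realpow power2_eq_square power_mult_distrib)
    with sums_divide[OF sums, of "\<gamma> powr s"]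
    show "(\<lambda>n. \<Sum>k<n. ?a k * (Gamma (s + real k) / \<gamma> powr (s + real k))) \<longlonglongrightarrow> S / \<gamma> powr s"
      by (simp add: sums_def)
  qed
  from has_integral_mult_right[OF this, of "exp (- \<gamma>)"] show ?thesis
    by (simp add: algebra_simps exp_diff exp_minus divide_inverse exp_add)
qed

text \<open>Case s = 1: the series is that of exp \<gamma>. The factor \<open>t powr 0\<close> is 1
  for t > 0 and 0 at t = 0.\<close>

lemma besselI_0_moment_0:
  assumes "0 < \<gamma>"
  shows "((\<lambda>t. t powr 0 * (exp (- \<gamma> * (1 + t)) * besselI 0 (2 * \<gamma> * sqrt t)))
    has_integral 1 / \<gamma>) {0..}"
proof -
  have "\<gamma> ^ k * Gamma (1 + real k) / (fact k)\<^sup>2 = \<gamma> ^ k /\<^sub>R fact k" for k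
    by (simp add: Gamma_fact power2_eq_square divide_inverse)
  with exp_converges[of \<gamma>] have "(\<lambda>k. \<gamma> ^ k * Gamma (1 + real k) / (fact k)\<^sup>2) sums exp \<gamma>"
    by simp
  from besselI_0_moment[OF zero_less_one assms this] assms show ?thesis
    by (simp add: exp_minus)
qed

text \<open>Case s = 2: Gamma(2 + k) = (k+1)!, and the sum of (k+1) \<gamma>^k / k! is (1 +
  \<gamma>) exp \<gamma>.\<close>

lemma besselI_0_moment_1:
  assumes "0 < \<gamma>"
  shows "((\<lambda>t. t powr 1 * (exp (- \<gamma> * (1 + t)) * besselI 0 (2 * \<gamma> * sqrt t)))
    has_integral 1 / \<gamma> + 1 / \<gamma>\<^sup>2) {0..}"
proof -
  have "(\<lambda>k. real (Suc k) * \<gamma> ^ Suc k / fact (Suc k)) sums (\<gamma> * exp \<gamma>)"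
  proof -
    have "real (Suc k) * \<gamma> ^ Suc k / fact (Suc k) = \<gamma> * (\<gamma> ^ k /\<^sub>R fact k)" for k
      by (simp add: field_simps del: of_nat_Suc)
    with sums_mult[OF exp_converges[of \<gamma>], of \<gamma>] show ?thesis by simp
  qed
  from sums_Suc_imp[OF _ this] have "(\<lambda>k. real k * \<gamma> ^ k / fact k) sums (\<gamma> * exp \<gamma>)"
    by simp
  from sums_add[OF exp_converges[of \<gamma>] this]
  have "(\<lambda>k. \<gamma> ^ k /\<^sub>R fact k + real k * \<gamma> ^ k / fact k) sums ((1 + \<gamma>) * exp \<gamma>)"
    by (simp add: algebra_simps)
  also have "(\<lambda>k. \<gamma> ^ k /\<^sub>R fact k + real k * \<gamma> ^ k / fact k) = (\<lambda>k. \<gamma> ^ k * Gamma (2 + real k) / (fact k)\<^sup>2)"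
  proof
    fix k
    have "Gamma (2 + real k) = fact (Suc k)"
      using Gamma_fact[of "Suc k", where ?'a = real] by (simp del: fact_Suc)
    then show "\<gamma> ^ k /\<^sub>R fact k + real k * \<gamma> ^ k / fact k = \<gamma> ^ k * Gamma (2 + real k) / (fact k)\<^sup>2"
      by (simp add: field_simps power2_eq_square)
  qed
  finally have "(\<lambda>k. \<gamma> ^ k * Gamma (2 + real k) / (fact k)\<^sup>2) sums ((1 + \<gamma>) * exp \<gamma>)" .
  from besselI_0_moment[OF _ assms this]
  have "((\<lambda>t. t powr 1 * (exp (- \<gamma> * (1 + t)) * besselI 0 (2 * \<gamma> * sqrt t)))
    has_integral exp (- \<gamma>) * ((1 + \<gamma>) * exp \<gamma> / \<gamma> powr 2)) {0..}"
    by simp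
  also have "exp (- \<gamma>) * ((1 + \<gamma>) * exp \<gamma> / \<gamma> powr 2) = 1 / \<gamma> + 1 / \<gamma>\<^sup>2"
    using assms by (simp add: exp_minus field_simps power2_eq_square)
  finally show ?thesis .
qed

text \<open>Case s = 3/2: Gamma(3/2 + k) = sqrt pi / 2 * (3/2)_k, so the series is the one summed by
  Kummer's identity. The factor 2 reflects \<gamma> t / z = sqrt t / 2.\<close>

lemma besselI_0_moment_half:
  assumes "0 < \<gamma>"
  shows "((\<lambda>t. t powr (1/2) * (exp (- \<gamma> * (1 + t)) * besselI 0 (2 * \<gamma> * sqrt t)))
    has_integral 2 * g_hat \<gamma>) {0..}"
proof -
  let ?B = "(1 + \<gamma>) * besselI 0 (\<gamma> / 2) + \<gamma> * besselI 1 (\<gamma> / 2)"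
  have G: "Gamma (3/2 :: real) = sqrt pi / 2"
  proof -
    have "(1/2 :: real) \<notin> \<int>\<^sub>\<le>\<^sub>0" by (auto elim!: nonpos_Ints_cases)
    from Gamma_plus1[OF this] show ?thesis by (simp add: Gamma_one_half_real)
  qed
  have "\<gamma> ^ k * Gamma (3/2 + real k) / (fact k)\<^sup>2 = sqrt pi / 2 * (pochhammer (3/2) k * \<gamma> ^ k / (fact k)\<^sup>2)" for k
    by (subst pochhammer_Gamma) (auto simp: G elim!: nonpos_Ints_cases)
  with sums_mult[OF kummer_three_halves_sums[of \<gamma>], of "sqrt pi / 2"]
  have "(\<lambda>k. \<gamma> ^ k * Gamma (3/2 + real k) / (fact k)\<^sup>2) sums (sqrt pi / 2 * (exp (\<gamma> / 2) * ?B))"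
    by simp
  from besselI_0_moment[OF _ assms this]
  have *: "((\<lambda>t. t powr (1/2) * (exp (- \<gamma> * (1 + t)) * besselI 0 (2 * \<gamma> * sqrt t)))
    has_integral exp (- \<gamma>) * (sqrt pi / 2 * (exp (\<gamma> / 2) * ?B) / \<gamma> powr (3/2))) {0..}"
    by simp
  have e: "exp (- \<gamma>) * exp (\<gamma> / 2) = exp (- \<gamma> / 2)" by (simp flip: exp_add)
  have "\<gamma> powr (3/2) = \<gamma> * sqrt \<gamma>"
    using assms powr_add[of \<gamma> 1 "1/2"] by (simp add: powr_half_sqrt)
  then have "exp (- \<gamma>) * (sqrt pi / 2 * (exp (\<gamma> / 2) * ?B) / \<gamma> powr (3/2))
      = (exp (- \<gamma>) * exp (\<gamma> / 2)) * (sqrt pi / 2 * ?B / (\<gamma> * sqrt \<gamma>))"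
    by simp
  also have "\<dots> = 2 * g_hat \<gamma>"
    unfolding e g_hat_def real_sqrt_divide using assms by (simp add: field_simps)
  finally show ?thesis using * by simp
qed

lemma g_hat_le:
  assumes "0 < \<gamma>"
  shows "g_hat \<gamma> \<le> 1 / (2 * \<gamma>) + 1 / (4 * \<gamma>\<^sup>2)"
proof -
  let ?w = "\<lambda>t. exp (- \<gamma> * (1 + t)) * besselI 0 (2 * \<gamma> * sqrt t)"
  have "2 * g_hat \<gamma> \<le> 1/2 * (1 / \<gamma> + (1 / \<gamma> + 1 / \<gamma>\<^sup>2))"
  proof (rule has_integral_le[OF besselI_0_moment_half[OF assms]])
    show "((\<lambda>t. 1/2 * (t powr 0 * ?w t + t powr 1 * ?w t)) has_integral
        1/2 * (1 / \<gamma> + (1 / \<gamma> + 1 / \<gamma>\<^sup>2))) {0..}"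
      by (intro has_integral_mult_right has_integral_add besselI_0_moment_0 besselI_0_moment_1 assms)
    fix t :: real assume t: "t \<in> {0..}"
    \<comment> \<open>The arithmetic-geometric mean inequality for 1 and t; at t = 0 both sides are
      0.\<close>
    have "t powr (1/2) \<le> 1/2 * (t powr 0 + t powr 1)"
      using t arith_geo_mean_sqrt[of 1 t] by (auto simp: powr_half_sqrt)
    then have "t powr (1/2) * ?w t \<le> 1/2 * (t powr 0 + t powr 1) * ?w t"
      by (rule mult_right_mono) (simp add: besselI_0_pos less_imp_le)
    then show "t powr (1/2) * ?w t \<le> 1/2 * (t powr 0 * ?w t + t powr 1 * ?w t)"
      by (simp add: algebra_simps)
  qed
  then show ?thesis by (simp add: field_simps)
qed

section \<open>Integral estimate of g_hat - g\<close>

lemma continuous_on_besselI_0: "continuous_on A (besselI 0)"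
  by (meson DERIV_besselI_0 DERIV_isCont continuous_at_imp_continuous_on)

lemma continuous_on_besselR: "continuous_on A besselR"
proof -
  have "isCont (besselI 1) z" for z
    by (rule DERIV_besselI_1[of z]) (rule DERIV_isCont)
  then have "continuous_on A (besselI 1)" by (simp add: continuous_at_imp_continuous_on)
  then show ?thesis
    unfolding besselR_def[abs_def]
    by (intro continuous_intros continuous_on_besselI_0) (use besselI_0_pos in \<open>auto simp: less_le\<close>)
qed

lemma besselR_square_le_1:
  assumes "0 \<le> z"
  shows "(besselR z)\<^sup>2 \<le> 1"
proof -
  have "0 \<le> besselR z" "besselR z \<le> 1"
    using besselI_nonneg[OF assms] besselI_1_le_0[OF assms] besselI_0_pos[of z]
    by (auto simp: besselR_def)
  then show ?thesis by (simp add: power_le_one)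
qed

text \<open>The pointwise error 2/z^2 = 1/(2 \<gamma>^2 t), multiplied by \<gamma> t, leaves the
  constant 1/(2 \<gamma>) times the weight of mass 1/\<gamma>.\<close>

lemma abs_g_hat_diff_le:
  assumes "0 < \<gamma>"
  shows "\<bar>g_hat \<gamma> - g_fun \<gamma>\<bar> \<le> 1 / (2 * \<gamma>\<^sup>2)"
proof -
  let ?w = "\<lambda>t. exp (- \<gamma> * (1 + t)) * besselI 0 (2 * \<gamma> * sqrt t)"
  let ?g = "\<lambda>t. \<gamma> * t * exp (- \<gamma> * (1 + t)) * besselI 0 (2 * \<gamma> * sqrt t)
                   * (1 - (besselR (2 * \<gamma> * sqrt t))\<^sup>2)"
  \<comment> \<open>\<open>integral\<close> has a default value on non-integrable functions, so
    integrability comes first. As 0 \<le> 1 - R^2 \<le> 1, the integrand is dominated by that of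
    \<gamma> times the first moment.\<close>
  have "?g integrable_on {0..}"
  proof (rule measurable_bounded_by_integrable_imp_integrable)
    have "continuous_on {0..} ?g"
      by (intro continuous_intros continuous_on_compose2[OF continuous_on_besselI_0[of UNIV]]
          continuous_on_compose2[OF continuous_on_besselR[of UNIV]]) auto
    then show "?g \<in> borel_measurable (lebesgue_on {0..})"
      by (rule continuous_imp_measurable_on_sets_lebesgue) simp
    show "(\<lambda>t. \<gamma> * (t powr 1 * ?w t)) integrable_on {0..}"
      using has_integral_mult_right[OF besselI_0_moment_1[OF assms], of \<gamma>] by blast
    fix t :: real assume t: "t \<in> {0..}"
    let ?r = "(besselR (2 * \<gamma> * sqrt t))\<^sup>2"
    have r: "0 \<le> 1 - ?r" "1 - ?r \<le> 1"
      using besselR_square_le_1[of "2 * \<gamma> * sqrt t"] t assms by auto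
    have eq: "?g t = \<gamma> * t * ?w t * (1 - ?r)" by (simp add: mult.assoc)
    have "norm (?g t) = \<gamma> * t * ?w t * (1 - ?r)"
      unfolding eq real_norm_def
      using r t assms besselI_0_pos[of "2 * \<gamma> * sqrt t"]
      by (intro abs_of_nonneg mult_nonneg_nonneg) auto
    also have "\<dots> \<le> \<gamma> * t * ?w t * 1"
      using r t assms besselI_0_pos[of "2 * \<gamma> * sqrt t"]
      by (intro mult_left_mono mult_nonneg_nonneg) auto
    also have "\<dots> = \<gamma> * (t powr 1 * ?w t)" using t by simp
    finally show "norm (?g t) \<le> \<gamma> * (t powr 1 * ?w t)" .
  qed simp
  then have g: "(?g has_integral g_fun \<gamma>) {0..}"
    unfolding g_fun_def by (rule integrable_integral)
  have d: "((\<lambda>t. 1/2 * (t powr (1/2) * ?w t) - ?g t) has_integral 1/2 * (2 * g_hat \<gamma>) - g_fun \<gamma>) {0..}"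
    by (intro has_integral_diff has_integral_mult_right besselI_0_moment_half g assms)
  have b: "((\<lambda>t. 1 / (2 * \<gamma>) * (t powr 0 * ?w t)) has_integral 1 / (2 * \<gamma>) * (1 / \<gamma>)) {0..}"
    by (intro has_integral_mult_right besselI_0_moment_0 assms)
  have bound: "norm (1/2 * (t powr (1/2) * ?w t) - ?g t) \<le> 1 / (2 * \<gamma>) * (t powr 0 * ?w t)"
    if t: "t \<in> {0..}" for t
  \<comment> \<open>For t > 0 the expansion at z applies; at t = 0 everything vanishes, since
    \<open>0 powr 0 = 0\<close>.\<close>
  proof (cases "t = 0")
    case False
    with t have t: "0 < t" by simp
    let ?z = "2 * \<gamma> * sqrt t"
    have z: "0 < ?z" using t assms by simp
    have zz: "?z\<^sup>2 = 4 * \<gamma>\<^sup>2 * t" using t by (simp add: power_mult_distrib)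
    define y where "y = 1 / ?z"
    have p: "t powr (1/2) = 2 * (\<gamma> * t * y)"
      using t assms by (simp add: y_def powr_half_sqrt real_div_sqrt)
    have "1/2 * (t powr (1/2) * ?w t) - ?g t = \<gamma> * t * ?w t * (y - (1 - (besselR ?z)\<^sup>2))"
      unfolding p by (simp add: algebra_simps)
    also have "\<dots> = \<gamma> * t * ?w t * (1 / ?z - (1 - (besselR ?z)\<^sup>2))"
      by (simp only: y_def)
    also have "norm \<dots> = \<gamma> * t * ?w t * \<bar>1 / ?z - (1 - (besselR ?z)\<^sup>2)\<bar>"
      using t assms besselI_0_pos[of ?z] by (simp add: abs_mult)
    also have "\<dots> \<le> \<gamma> * t * ?w t * (2 / ?z\<^sup>2)"
      using t assms besselI_0_pos[of ?z] besselR_asymptotic[OF z]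
      by (intro mult_left_mono mult_nonneg_nonneg) auto
    also have "\<dots> = 1 / (2 * \<gamma>) * (t powr 0 * ?w t)"
      unfolding zz using t assms by (simp add: power2_eq_square)
    finally show ?thesis .
  qed simp
  have "norm (1/2 * (2 * g_hat \<gamma>) - g_fun \<gamma>) \<le> 1 / (2 * \<gamma>) * (1 / \<gamma>)"
    using integral_norm_bound_integral[OF has_integral_integrable[OF d] has_integral_integrable[OF b] bound]
    unfolding integral_unique[OF d] integral_unique[OF b] .
  then show ?thesis by (simp add: power2_eq_square)
qed

theorem theorem3:
  shows "rel_err \<in> O[at_top](\<lambda>\<gamma>. 1 / \<gamma>)"
\<comment> \<open>The constant 2 comes from dividing the error bound 1/(2 \<gamma>^2) by the
  denominator bound 1/(4 \<gamma>).\<close>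
proof (rule bigoI[where c = 2], rule eventually_at_top_linorderI[of 3])
  fix \<gamma> :: real assume \<gamma>: "3 \<le> \<gamma>"
  have 1: "\<bar>g_hat \<gamma> - g_fun \<gamma>\<bar> \<le> 1 / (2 * \<gamma>\<^sup>2)" "g_hat \<gamma> \<le> 1 / (2 * \<gamma>) + 1 / (4 * \<gamma>\<^sup>2)"
    using abs_g_hat_diff_le[of \<gamma>] g_hat_le[of \<gamma>] \<gamma> by auto
  \<comment> \<open>After multiplication by 4 \<gamma>^2 this reads 2 \<gamma> + 3 \<le> 3 \<gamma>,
    whence the threshold 3.\<close>
  have "1 / (2 * \<gamma>) + 1 / (4 * \<gamma>\<^sup>2) + 1 / (2 * \<gamma>\<^sup>2) \<le> 1 / \<gamma> - 1 / (4 * \<gamma>)"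
    using \<gamma> by (simp add: divide_simps power2_eq_square)
  with 1 have den: "1 / (4 * \<gamma>) \<le> 1 / \<gamma> - g_fun \<gamma>" by linarith
  have pos: "0 < 1 / (4 * \<gamma>)" using \<gamma> by simp
  have "rel_err \<gamma> \<le> 1 / (2 * \<gamma>\<^sup>2) / (1 / (4 * \<gamma>))"
    unfolding rel_err_def using 1(1) den pos by (intro frac_le) auto
  also have "\<dots> = 2 * (1 / \<gamma>)" using \<gamma> by (simp add: power2_eq_square)
  finally have "rel_err \<gamma> \<le> 2 * (1 / \<gamma>)" .
  moreover have "0 \<le> rel_err \<gamma>" unfolding rel_err_def using den pos by (intro divide_nonneg_nonneg abs_ge_zero) linarith
  ultimately show "norm (rel_err \<gamma>) \<le> 2 * norm (1 / \<gamma>)" using \<gamma> by simp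
qed

end
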